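(* Let $D$ be the set of $82$ squares of $Q_{163}$ listed in the context. All coordinates of squares of $D$ are odd, every odd row and every odd column contains exactly one square of $D$, and $D$ is a type A $1$-cover of $Q_{163}$ with parameters $e(D)=16$, $f(D)=15$, $u(D)=24$.
   Context: The squares of the $163\times163$ board $Q_{163}$ (so $n=163$) are identified with $B=\{(x,y)\in\mathbb{Z}^2:-81\leq x,y\leq 81\}$, where $x$ is the column number and $y$ the row number. The square $(x,y)$ lies on difference diagonal $y-x$ and on sum diagonal $x+y$. Two squares share a diagonal if they have the same difference diagonal or the same sum diagonal. A row, column or diagonal is occupied by a set of squares if it contains a square of the set. The two long diagonals are difference diagonal $0$ and sum diagonal $0$. For $p\in\{0,1\}$, a set of squares is $p$-orthodox if every row and every column whose number has parity $p$ contains a square of the set. A $1$-orthodox set is a $1$-cover if every even-even square (both coordinates even) shares a diagonal with a square of the set. For a set $D$ containing a square on each long diagonal: - $e=e(D)$ is the largest integer such that every difference diagonal $2i$ with $|i|\leq e$ is occupied; - $f=f(D)$ is the largest integer such that every sum diagonal $2i$ with $|i|\leq f$ is occupied; - $u=u(D)$ is the largest integer such that for every $1\leq i\leq u$ all four of the difference diagonals $\pm(2e+4i)$ and the sum diagonals $\pm(2f+4i)$ are occupied. A $p$-orthodox set with both long diagonals occupied is a type A $p$-cover of $Q_n$ when $e+f\equiv p\pmod 2$ and $e+f+2u\geq\frac{n-5}{2}$. (By a known theorem of Östergård and Weakley such a set is a $p$-cover; for $p=1$, this means that the set is $1$-orthodox and every even-even square shares a diagonal with a square of the set.) The set $D\subseteq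 B$ consists of the following $82$ squares: (-81,-41), (-79,-19), (-77,31), (-75,25), (-73,-9), (-71,49), (-69,55), (-67,-39), (-65,-29), (-63,-51), (-61,51), (-59,-67), (-57,15), (-55,-23), (-53,27), (-51,77), (-49,-69), (-47,57), (-45,-25), (-43,-43), (-41,75), (-39,-71), (-37,39), (-35,-45), (-33,-57), (-31,61), (-29,-33), (-27,69), (-25,-77), (-23,65), (-21,-7), (-19,11), (-17,67), (-15,53), (-13,-11), (-11,-5), (-9,13), (-7,19), (-5,-61), (-3,-17), (-1,9), (1,-1), (3,21), (5,-63), (7,-81), (9,-21), (11,-15), (13,7), (15,59), (17,73), (19,-3), (21,-75), (23,5), (25,-59), (27,79), (29,37), (31,-49), (33,81), (35,23), (37,41), (39,63), (41,-79), (43,-73), (45,-31), (47,47), (49,-55), (51,35), (53,-47), (55,71), (57,-35), (59,-13), (61,1), (63,-65), (65,17), (67,3), (69,29), (71,-53), (73,45), (75,-37), (77,33), (79,43), (81,-27). *)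

theory Defs
  imports Complex_Main "HOL-Number_Theory.Cong"
begin

text \<open>
  Throughout, the board size \<open>n\<close> is meant to be odd: the square in column \<open>x\<close> and row \<open>y\<close> is the
  pair \<open>(x, y)\<close>, with the central square at the origin.
\<close>

type_synonym square = "int \<times> int"

definition line_numbers :: "nat \<Rightarrow> int set" where
  "line_numbers n = {- ((int n - 1) div 2) .. (int n - 1) div 2}"

definition board :: "nat \<Rightarrow> square set" where
  "board n = line_numbers n \<times> line_numbers n"

definition col_occupied :: "square set \<Rightarrow> int \<Rightarrow> bool" where
  "col_occupied D c \<longleftrightarrow> (\<exists>(x, y) \<in> D. x = c)"

definition row_occupied :: "square set \<Rightarrow> int \<Rightarrow> bool" where
  "row_occupied D r \<longleftrightarrow> (\<exists>(x, y) \<in> D. y = r)"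

definition diff_diag_occupied :: "square set \<Rightarrow> int \<Rightarrow> bool" where
  "diff_diag_occupied D d \<longleftrightarrow> (\<exists>(x, y) \<in> D. y - x = d)"

definition sum_diag_occupied :: "square set \<Rightarrow> int \<Rightarrow> bool" where
  "sum_diag_occupied D s \<longleftrightarrow> (\<exists>(x, y) \<in> D. x + y = s)"

definition long_diags_occupied :: "square set \<Rightarrow> bool" where
  "long_diags_occupied D \<longleftrightarrow> diff_diag_occupied D 0 \<and> sum_diag_occupied D 0"

definition orthodox :: "nat \<Rightarrow> int \<Rightarrow> square set \<Rightarrow> bool" where
  "orthodox n p D \<longleftrightarrow>
     (\<forall>k \<in> line_numbers n. [k = p] (mod 2) \<longrightarrow> row_occupied D k \<and> col_occupied D k)"

text \<open>
  The next three parameters are only meaningful for a finite set \<open>D\<close> that occupies both long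
  diagonals; for such \<open>D\<close> the maxima exist and are nonnegative.
\<close>

definition e_param :: "square set \<Rightarrow> int" where
  "e_param D = (GREATEST e. \<forall>i. \<bar>i\<bar> \<le> e \<longrightarrow> diff_diag_occupied D (2 * i))"

definition f_param :: "square set \<Rightarrow> int" where
  "f_param D = (GREATEST f. \<forall>i. \<bar>i\<bar> \<le> f \<longrightarrow> sum_diag_occupied D (2 * i))"

definition u_param :: "square set \<Rightarrow> int" where
  "u_param D = (GREATEST u. \<forall>i. 1 \<le> i \<and> i \<le> u \<longrightarrow>
     diff_diag_occupied D (2 * e_param D + 4 * i) \<and>
     diff_diag_occupied D (- (2 * e_param D + 4 * i)) \<and>
     sum_diag_occupied D (2 * f_param D + 4 * i) \<and>
     sum_diag_occupied D (- (2 * f_param D + 4 * i)))"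

definition type_A_cover :: "nat \<Rightarrow> int \<Rightarrow> square set \<Rightarrow> bool" where
  "type_A_cover n p D \<longleftrightarrow>
     D \<subseteq> board n \<and>
     orthodox n p D \<and>
     long_diags_occupied D \<and>
     [e_param D + f_param D = p] (mod 2) \<and>
     real_of_int (e_param D + f_param D + 2 * u_param D) \<ge> (real n - 5) / 2"

definition D163 :: "square set" where
  "D163 = {
    (-81,-41), (-79,-19), (-77,31), (-75,25), (-73,-9), (-71,49),
    (-69,55), (-67,-39), (-65,-29), (-63,-51), (-61,51), (-59,-67),
    (-57,15), (-55,-23), (-53,27), (-51,77), (-49,-69), (-47,57),
    (-45,-25), (-43,-43), (-41,75), (-39,-71), (-37,39), (-35,-45),
    (-33,-57), (-31,61), (-29,-33), (-27,69), (-25,-77), (-23,65),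
    (-21,-7), (-19,11), (-17,67), (-15,53), (-13,-11), (-11,-5),
    (-9,13), (-7,19), (-5,-61), (-3,-17), (-1,9), (1,-1),
    (3,21), (5,-63), (7,-81), (9,-21), (11,-15), (13,7),
    (15,59), (17,73), (19,-3), (21,-75), (23,5), (25,-59),
    (27,79), (29,37), (31,-49), (33,81), (35,23), (37,41),
    (39,63), (41,-79), (43,-73), (45,-31), (47,47), (49,-55),
    (51,35), (53,-47), (55,71), (57,-35), (59,-13), (61,1),
    (63,-65), (65,17), (67,3), (69,29), (71,-53), (73,45),
    (75,-37), (77,33), (79,43), (81,-27)}"

end

theory Submission
  imports Defs
begin

text \<open>
  All assertions concern a fixed finite configuration, so each reduces to membership in the images
  of \<^const>\<open>D163\<close> under the four maps \<open>x\<close>, \<open>y\<close>, \<open>y - x\<close> and \<open>x + y\<close>: a row, column or diagonal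
  is occupied iff its number lies in the corresponding image. These are finite tests, carried out
  by rewriting. Two points remain.

  Uniqueness of the square in an odd row or column is not tested pair by pair: the \<open>82\<close> listed
  squares occupy all \<open>82\<close> odd lines of each kind, so by the pigeonhole principle
  (\<open>ex1_on_line\<close>) no line receives two of them.

  Each of \<open>e\<close>, \<open>f\<close>, \<open>u\<close> is the greatest integer with a property that is inherited by smaller
  integers (\<open>Greatest_threshold\<close>). Hence it is enough that the property holds at the claimed value
  and fails at the next one; the failures come from the empty difference diagonal \<open>34 = 2 * 17\<close>,
  the empty sum diagonal \<open>32 = 2 * 16\<close> and the empty difference diagonal \<open>132 = 2 * 16 + 4 * 25\<close>.
  The inequality for a type A cover is then the equality \<open>16 + 15 + 2 * 24 = 79 = (163 - 5) / 2\<close>.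
\<close>

lemma Greatest_threshold:
  fixes P :: "int \<Rightarrow> bool"
  assumes down: "\<And>a b. P b \<Longrightarrow> a \<le> b \<Longrightarrow> P a"
    and "P k" and "\<not> P (k + 1)"
  shows "(GREATEST i. P i) = k"
proof (rule Greatest_equality)
  fix i assume "P i"
  show "i \<le> k"
  proof (rule ccontr)
    assume "\<not> i \<le> k"
    then have "P (k + 1)" using down[OF \<open>P i\<close>, of "k + 1"] by simp
    then show False using \<open>\<not> P (k + 1)\<close> by contradiction
  qed
qed fact

text \<open>
  The hypotheses force \<open>g\<close> to take at least as many values on \<open>D\<close> as \<open>D\<close> has elements, so \<open>g\<close>
  is injective there. For \<open>g = snd\<close> and \<open>L\<close> the odd rows this gives at most one square per row.
\<close>

lemma ex1_on_line:
  assumes "finite D" "card D \<le> card L" "L \<subseteq> g ` D" "r \<in> L"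
  shows "\<exists>!q. q \<in> D \<and> g q = r"
proof -
  have "card L \<le> card (g ` D)"
    using assms by (intro card_mono) auto
  then have "card (g ` D) = card D"
    using assms(2) card_image_le[OF assms(1), of g] by linarith
  then have "inj_on g D"
    using assms(1) by (rule eq_card_imp_inj_on[rotated])
  then show ?thesis
    using assms(3,4) by (auto simp: inj_on_def)
qed

lemma ball_int_range: "(\<forall>i \<in> {a..b::int}. P i) \<longleftrightarrow> list_all P [a..b]"
  by (simp add: list_all_iff)

text \<open>
  An interval such as \<open>[-16..16]\<close> is enumerated from its lower end; the lower ends \<open>-1\<close>, \<open>0\<close>
  and \<open>1\<close> met on the way are not of the form \<open>numeral m\<close> or \<open>- numeral m\<close> and need rules of their own.
\<close>

lemmas int_range_simps =
  ball_int_range upto.simps[of "-1" "numeral n"] upto.simps[of 0 "numeral n"]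
  upto.simps[of 1 "numeral n"] for n

lemma occupied_iff_image:
  "col_occupied D c \<longleftrightarrow> c \<in> fst ` D"
  "row_occupied D r \<longleftrightarrow> r \<in> snd ` D"
  "diff_diag_occupied D d \<longleftrightarrow> d \<in> (\<lambda>(x, y). y - x) ` D"
  "sum_diag_occupied D s \<longleftrightarrow> s \<in> (\<lambda>(x, y). x + y) ` D"
  unfolding col_occupied_def row_occupied_def diff_diag_occupied_def sum_diag_occupied_def
  by force+

lemma odd_line_numbers_163:
  "{k \<in> line_numbers 163. odd k} = (\<lambda>i. 2 * i + 1) ` {-41..40}"
  by (auto simp: line_numbers_def image_iff elim!: oddE)

lemma D163_odd: "\<forall>(x, y) \<in> D163. odd x \<and> odd y"
  by (simp add: D163_def)

lemma D163_subset_board: "D163 \<subseteq> board 163"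
proof -
  have "\<forall>(x, y) \<in> D163. -81 \<le> x \<and> x \<le> 81 \<and> -81 \<le> y \<and> y \<le> 81"
    by (simp add: D163_def)
  then show ?thesis
    by (auto simp: board_def line_numbers_def)
qed

lemma D163_odd_lines:
  "{k \<in> line_numbers 163. odd k} \<subseteq> fst ` D163"
  "{k \<in> line_numbers 163. odd k} \<subseteq> snd ` D163"
proof -
  have "\<forall>i \<in> {-41..40}. 2 * i + 1 \<in> fst ` D163 \<and> 2 * i + 1 \<in> snd ` D163"
    by (simp add: D163_def int_range_simps)
  then show "{k \<in> line_numbers 163. odd k} \<subseteq> fst ` D163"
    "{k \<in> line_numbers 163. odd k} \<subseteq> snd ` D163"
    unfolding odd_line_numbers_163 by auto
qed

lemma D163_card_le: "finite D163" "card D163 \<le> card {k \<in> line_numbers 163. odd k}"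
proof -
  have "card {k \<in> line_numbers 163. odd k} = 82"
    unfolding odd_line_numbers_163 by (subst card_image) (auto simp: inj_on_def)
  moreover have "card D163 \<le> 82"
    unfolding D163_def by (simp add: card_insert_if)
  ultimately show "card D163 \<le> card {k \<in> line_numbers 163. odd k}"
    by simp
  show "finite D163"
    by (simp add: D163_def)
qed

lemma e_param_D163: "e_param D163 = 16"
proof -
  have "\<forall>i \<in> {-16..16}. diff_diag_occupied D163 (2 * i)"
    unfolding occupied_iff_image by (simp add: D163_def int_range_simps)
  moreover have "\<not> diff_diag_occupied D163 34"
    unfolding occupied_iff_image by (simp add: D163_def)
  ultimately show ?thesis
    unfolding e_param_def
    by (intro Greatest_threshold) (auto simp: abs_le_iff intro!: exI[of _ 17])
qed

lemma f_param_D163: "f_param D163 = 15"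
proof -
  have "\<forall>i \<in> {-15..15}. sum_diag_occupied D163 (2 * i)"
    unfolding occupied_iff_image by (simp add: D163_def int_range_simps)
  moreover have "\<not> sum_diag_occupied D163 32"
    unfolding occupied_iff_image by (simp add: D163_def)
  ultimately show ?thesis
    unfolding f_param_def
    by (intro Greatest_threshold) (auto simp: abs_le_iff intro!: exI[of _ 16])
qed

lemma u_param_D163: "u_param D163 = 24"
proof -
  have "\<forall>i \<in> {1..24}. diff_diag_occupied D163 (32 + 4 * i) \<and>
      diff_diag_occupied D163 (- (32 + 4 * i)) \<and>
      sum_diag_occupied D163 (30 + 4 * i) \<and> sum_diag_occupied D163 (- (30 + 4 * i))"
    unfolding occupied_iff_image by (simp add: D163_def int_range_simps)
  moreover have "\<not> diff_diag_occupied D163 132"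
    unfolding occupied_iff_image by (simp add: D163_def)
  ultimately show ?thesis
    unfolding u_param_def e_param_D163 f_param_D163
    by (intro Greatest_threshold) (auto intro!: exI[of _ 25])
qed

lemma type_A_cover_D163: "type_A_cover 163 1 D163"
proof -
  have "orthodox 163 1 D163"
    using D163_odd_lines unfolding orthodox_def occupied_iff_image
    by (auto simp: cong_def odd_iff_mod_2_eq_one)
  moreover have "long_diags_occupied D163"
    unfolding long_diags_occupied_def occupied_iff_image by (simp add: D163_def)
  ultimately show ?thesis
    unfolding type_A_cover_def e_param_D163 f_param_D163 u_param_D163
    using D163_subset_board by (simp add: cong_def)
qed

theorem mainTheorem4:
  shows "(\<forall>(x, y) \<in> D163. odd x \<and> odd y) \<and>
    (\<forall>r \<in> line_numbers 163. odd r \<longrightarrow> (\<exists>!q. q \<in> D163 \<and> snd q = r)) \<and>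
    (\<forall>c \<in> line_numbers 163. odd c \<longrightarrow> (\<exists>!q. q \<in> D163 \<and> fst q = c)) \<and>
    type_A_cover 163 1 D163 \<and>
    e_param D163 = 16 \<and> f_param D163 = 15 \<and> u_param D163 = 24"
proof -
  have "\<exists>!q. q \<in> D163 \<and> snd q = r" if "r \<in> line_numbers 163" "odd r" for r
    using that by (intro ex1_on_line[OF D163_card_le D163_odd_lines(2)]) simp
  moreover have "\<exists>!q. q \<in> D163 \<and> fst q = c" if "c \<in> line_numbers 163" "odd c" for c
    using that by (intro ex1_on_line[OF D163_card_le D163_odd_lines(1)]) simp
  ultimately show ?thesis
    using D163_odd type_A_cover_D163 e_param_D163 f_param_D163 u_param_D163 by blast
qed

end
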